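(* (Termination.) The tableau system $\mathsf{TC}_{\mathsf{SCI}}$ is terminating: for every $\mathsf{SCI}$-formula $\varphi$ and every label $w$, every $\mathsf{TC}_{\mathsf{SCI}}$-tableau with root $w:\varphi$, built by applying the rules subject to the applicability restrictions, is finite (rule application cannot continue indefinitely).
   Context: Logic SCI. Fix a countably infinite set $\mathsf{AF}$ of atomic formulas. The set $\mathsf{FOR}$ of SCI-formulas is given by $\varphi ::= p \mid \neg\varphi \mid \varphi\to\varphi \mid \varphi\equiv\varphi$ with $p\in\mathsf{AF}$. Tableau system $\mathsf{TC}_{\mathsf{SCI}}$. Let $\mathsf{L}^+,\mathsf{L}^-$ be disjoint countably infinite sets of labels, $\mathsf{L}=\mathsf{L}^+\cup\mathsf{L}^-$; a label written $w^+$ lies in $\mathsf{L}^+$, $w^-$ in $\mathsf{L}^-$, an unsuperscripted label is arbitrary. A labelled formula is $w:\varphi$ with $w\in\mathsf{L},\varphi\in\mathsf{FOR}$. Equality statements $w=v$ and inequality statements $w\neq v$ may also occur. A tableau is a tree whose nodes carry labelled formulas, (in)equality statements or $\bot$; a branch is a root-to-leaf path, identified with the set of items on it. Rules (premises / alternative conclusion sets separated by $\mid$): Decomposition rules (all labels in the conclusions are fresh on the branch): $(\neg^+)$ $w^+:\neg\varphi$ / $v^-:\varphi$; $(\neg^-)$ $w^-:\neg\varphi$ / $v^+:\varphi$; $(\to^+)$ $w^+:\varphi\to\psi$ / $\{v^-:\varphi,u^-:\psi\}\mid\{v^-:\varphi,u^+:\psi\}\mid\{v^+:\varphi,u^+:\psi\}$;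 $(\to^-)$ $w^-:\varphi\to\psi$ / $\{v^+:\varphi,u^-:\psi\}$; $(\equiv^+)$ $w^+:\varphi\equiv\psi$ / $\{v^+:\varphi,u^+:\psi,v^+=u^+\}\mid\{v^-:\varphi,u^-:\psi,v^-=u^-\}$; $(\equiv^-)$ $w^-:\varphi\equiv\psi$ / $\{v^+:\varphi,u^+:\psi,v^+\neq u^+\}\mid\{v^+:\varphi,u^-:\psi\}\mid\{v^-:\varphi,u^+:\psi\}\mid\{v^-:\varphi,u^-:\psi,v^-\neq u^-\}$. Equality rules, where $\varphi\approx\psi$ abbreviates the three premises $w:\varphi$, $v:\psi$, $w=v$ for some labels $w,v$: $(\equiv^\neg)$ $\varphi\approx\psi$, $u:\neg\varphi$, $y:\neg\psi$ / $u=y$; $(\equiv^\to)$ $\varphi\approx\psi$, $\chi\approx\theta$, $x:\varphi\to\chi$, $z:\psi\to\theta$ / $x=z$; $(\equiv^\equiv)$ $\varphi\approx\psi$, $\chi\approx\theta$, $x:\varphi\equiv\chi$, $z:\psi\equiv\theta$ / $x=z$; $(\mathsf F)$ $w:\varphi$, $v:\varphi$ / $w=v$; $(\mathsf{sym})$ $w=v$ / $v=w$; $(\mathsf{tran})$ $w=v$, $v=u$ / $w=u$. Closure rules: $(\bot_1)$ $w=v$, $w\neq v$ / $\bot$; $(\bot_2)$ $w^+=v^-$ / $\bot$. Applicability restrictions: a decomposition rule may be applied to $w:\varphi$ on a branch only if it has not been applied to $w:\varphi$ on that branch before; an equality rule may be applied to premises on a branch only if its conclusion is not already on that branch; closure rules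 are applied eagerly, and a branch on which a closure rule has been applied (a closed branch) is not extended further. *)

theory Defs
  imports "HOL-Library.Countable_Set"
begin

datatype (atoms: 'a) fm =
    Atom 'a
  | Neg "'a fm"
  | Imp "'a fm" "'a fm"
  | Equ "'a fm" "'a fm"

definition FOR :: "'a set \<Rightarrow> 'a fm set" where
  "FOR AF = {\<phi>. atoms \<phi> \<subseteq> AF}"

datatype (labels: 'l, 'a) item =
    LForm 'l "'a fm"
  | EqL 'l 'l
  | NeqL 'l 'l
  | Bot

definition fresh :: "('l, 'a) item set \<Rightarrow> 'l \<Rightarrow> bool" where
  "fresh B v \<longleftrightarrow> v \<notin> (\<Union>i\<in>B. labels i)"

definition fresh_pair :: "('l, 'a) item set \<Rightarrow> 'l set \<Rightarrow> 'l set \<Rightarrow> 'l \<Rightarrow> 'l \<Rightarrow> bool" where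
  "fresh_pair B V U v u \<longleftrightarrow> v \<in> V \<and> u \<in> U \<and> fresh B v \<and> fresh B u \<and> v \<noteq> u"

text \<open>
  \<open>decomp_rule Lp Lm B w \<phi> Cs\<close>: on the branch \<open>B\<close>, the labelled formula \<open>w : \<phi>\<close> can be
  decomposed into the alternative conclusion sets \<open>Cs\<close>. A fresh label only has to be new to
  the branch it is put on, so each alternative picks its labels independently of the others.
\<close>

inductive decomp_rule ::
    "'l set \<Rightarrow> 'l set \<Rightarrow> ('l, 'a) item set \<Rightarrow> 'l \<Rightarrow> 'a fm \<Rightarrow> ('l, 'a) item set list \<Rightarrow> bool"
  for Lp Lm :: "'l set" and B :: "('l, 'a) item set"
where
  neg_pos:
    "\<lbrakk>w \<in> Lp; LForm w (Neg \<phi>) \<in> B; v \<in> Lm; fresh B v\<rbrakk>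
     \<Longrightarrow> decomp_rule Lp Lm B w (Neg \<phi>) [{LForm v \<phi>}]"
| neg_neg:
    "\<lbrakk>w \<in> Lm; LForm w (Neg \<phi>) \<in> B; v \<in> Lp; fresh B v\<rbrakk>
     \<Longrightarrow> decomp_rule Lp Lm B w (Neg \<phi>) [{LForm v \<phi>}]"
| imp_pos:
    "\<lbrakk>w \<in> Lp; LForm w (Imp \<phi> \<psi>) \<in> B;
      fresh_pair B Lm Lm v1 u1; fresh_pair B Lm Lp v2 u2; fresh_pair B Lp Lp v3 u3\<rbrakk>
     \<Longrightarrow> decomp_rule Lp Lm B w (Imp \<phi> \<psi>)
           [{LForm v1 \<phi>, LForm u1 \<psi>},
            {LForm v2 \<phi>, LForm u2 \<psi>},
            {LForm v3 \<phi>, LForm u3 \<psi>}]"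
| imp_neg:
    "\<lbrakk>w \<in> Lm; LForm w (Imp \<phi> \<psi>) \<in> B; fresh_pair B Lp Lm v u\<rbrakk>
     \<Longrightarrow> decomp_rule Lp Lm B w (Imp \<phi> \<psi>) [{LForm v \<phi>, LForm u \<psi>}]"
| equ_pos:
    "\<lbrakk>w \<in> Lp; LForm w (Equ \<phi> \<psi>) \<in> B;
      fresh_pair B Lp Lp v1 u1; fresh_pair B Lm Lm v2 u2\<rbrakk>
     \<Longrightarrow> decomp_rule Lp Lm B w (Equ \<phi> \<psi>)
           [{LForm v1 \<phi>, LForm u1 \<psi>, EqL v1 u1},
            {LForm v2 \<phi>, LForm u2 \<psi>, EqL v2 u2}]"
| equ_neg:
    "\<lbrakk>w \<in> Lm; LForm w (Equ \<phi> \<psi>) \<in> B;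
      fresh_pair B Lp Lp v1 u1; fresh_pair B Lp Lm v2 u2;
      fresh_pair B Lm Lp v3 u3; fresh_pair B Lm Lm v4 u4\<rbrakk>
     \<Longrightarrow> decomp_rule Lp Lm B w (Equ \<phi> \<psi>)
           [{LForm v1 \<phi>, LForm u1 \<psi>, NeqL v1 u1},
            {LForm v2 \<phi>, LForm u2 \<psi>},
            {LForm v3 \<phi>, LForm u3 \<psi>},
            {LForm v4 \<phi>, LForm u4 \<psi>, NeqL v4 u4}]"

definition approx :: "('l, 'a) item set \<Rightarrow> 'a fm \<Rightarrow> 'a fm \<Rightarrow> bool" where
  "approx B \<phi> \<psi> \<longleftrightarrow> (\<exists>w v. LForm w \<phi> \<in> B \<and> LForm v \<psi> \<in> B \<and> EqL w v \<in> B)"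

inductive equality_rule :: "('l, 'a) item set \<Rightarrow> ('l, 'a) item \<Rightarrow> bool"
  for B :: "('l, 'a) item set"
where
  eq_neg:
    "\<lbrakk>approx B \<phi> \<psi>; LForm u (Neg \<phi>) \<in> B; LForm y (Neg \<psi>) \<in> B\<rbrakk>
     \<Longrightarrow> equality_rule B (EqL u y)"
| eq_imp:
    "\<lbrakk>approx B \<phi> \<psi>; approx B \<chi> \<theta>; LForm x (Imp \<phi> \<chi>) \<in> B; LForm z (Imp \<psi> \<theta>) \<in> B\<rbrakk>
     \<Longrightarrow> equality_rule B (EqL x z)"
| eq_equ:
    "\<lbrakk>approx B \<phi> \<psi>; approx B \<chi> \<theta>; LForm x (Equ \<phi> \<chi>) \<in> B; LForm z (Equ \<psi> \<theta>) \<in> B\<rbrakk>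
     \<Longrightarrow> equality_rule B (EqL x z)"
| eq_F:
    "\<lbrakk>LForm w \<phi> \<in> B; LForm v \<phi> \<in> B\<rbrakk> \<Longrightarrow> equality_rule B (EqL w v)"
| eq_sym:
    "EqL w v \<in> B \<Longrightarrow> equality_rule B (EqL v w)"
| eq_tran:
    "\<lbrakk>EqL w v \<in> B; EqL v u \<in> B\<rbrakk> \<Longrightarrow> equality_rule B (EqL w u)"

inductive closure_rule :: "'l set \<Rightarrow> 'l set \<Rightarrow> ('l, 'a) item set \<Rightarrow> bool"
  for Lp Lm :: "'l set" and B :: "('l, 'a) item set"
where
  bot1: "\<lbrakk>EqL w v \<in> B; NeqL w v \<in> B\<rbrakk> \<Longrightarrow> closure_rule Lp Lm B"
| bot2: "\<lbrakk>EqL w v \<in> B; w \<in> Lp; v \<in> Lm\<rbrakk> \<Longrightarrow> closure_rule Lp Lm B"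

text \<open>
  \<open>applicable Lp Lm B D d Cs\<close>: subject to the applicability restrictions, some rule may be
  applied on the branch \<open>B\<close> and yields the alternative conclusion sets \<open>Cs\<close>. Here \<open>D\<close> is the
  set of labelled formulas already decomposed on the branch, and \<open>d\<close> is the labelled formula
  decomposed by this application (\<open>None\<close> for equality and closure rules). For disjoint \<open>Lp\<close> and
  \<open>Lm\<close> at most one decomposition rule matches a labelled formula, so \<open>D\<close> need not record
  the rule. Eagerness of closure means that other rules wait until no closure rule matches.
\<close>

inductive applicable ::
    "'l set \<Rightarrow> 'l set \<Rightarrow> ('l, 'a) item set \<Rightarrow> ('l \<times> 'a fm) set \<Rightarrow>
     ('l \<times> 'a fm) option \<Rightarrow> ('l, 'a) item set list \<Rightarrow> bool"
  for Lp Lm :: "'l set" and B :: "('l, 'a) item set" and D :: "('l \<times> 'a fm) set"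
where
  closure:
    "\<lbrakk>Bot \<notin> B; closure_rule Lp Lm B\<rbrakk> \<Longrightarrow> applicable Lp Lm B D None [{Bot}]"
| equality:
    "\<lbrakk>Bot \<notin> B; \<not> closure_rule Lp Lm B; equality_rule B c; c \<notin> B\<rbrakk>
     \<Longrightarrow> applicable Lp Lm B D None [{c}]"
| decomp:
    "\<lbrakk>Bot \<notin> B; \<not> closure_rule Lp Lm B; decomp_rule Lp Lm B w \<phi> Cs; (w, \<phi>) \<notin> D\<rbrakk>
     \<Longrightarrow> applicable Lp Lm B D (Some (w, \<phi>)) Cs"

text \<open>
  Possibly infinite trees. A node carries the items added there (all items of one conclusion
  set together), the labelled formula decomposed by the rule application that created its
  children (if that application was a decomposition), and the list of its children, one for
  each alternative.
\<close>

codatatype ('l, 'a) tree =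
  Node (items: "('l, 'a) item set") (decomposed: "('l \<times> 'a fm) option")
       (children: "('l, 'a) tree list")

abbreviation leaf :: "('l, 'a) item set \<Rightarrow> ('l, 'a) tree" where
  "leaf X \<equiv> Node X None []"

text \<open>
  In the following two predicates \<open>B\<close> and \<open>D\<close> collect the items and the decomposed labelled
  formulas on the path from the root to the current node; \<open>B\<close> includes the node's own items.
  The first one is coinductive, so it admits trees with infinite branches, obtained
  by applying rules forever.
\<close>

coinductive grown ::
    "'l set \<Rightarrow> 'l set \<Rightarrow> ('l, 'a) item set \<Rightarrow> ('l \<times> 'a fm) set \<Rightarrow> ('l, 'a) tree \<Rightarrow> bool"
  for Lp Lm :: "'l set"
where
  stop: "grown Lp Lm B D (leaf X)"
| apply_rule:
    "\<lbrakk>applicable Lp Lm B D d Cs; map items ts = Cs;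
      \<forall>t \<in> set ts. grown Lp Lm (B \<union> items t) (D \<union> set_option d) t\<rbrakk>
     \<Longrightarrow> grown Lp Lm B D (Node X d ts)"

definition tableau :: "'l set \<Rightarrow> 'l set \<Rightarrow> 'l \<Rightarrow> 'a fm \<Rightarrow> ('l, 'a) tree \<Rightarrow> bool" where
  "tableau Lp Lm w \<phi> T \<longleftrightarrow> items T = {LForm w \<phi>} \<and> grown Lp Lm {LForm w \<phi>} {} T"

text \<open>One rule application on a single branch, which extends the tree at the leaf of that branch.\<close>

inductive expands ::
    "'l set \<Rightarrow> 'l set \<Rightarrow> ('l, 'a) item set \<Rightarrow> ('l \<times> 'a fm) set \<Rightarrow>
     ('l, 'a) tree \<Rightarrow> ('l, 'a) tree \<Rightarrow> bool"
  for Lp Lm :: "'l set"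
where
  here:
    "applicable Lp Lm B D d Cs \<Longrightarrow> expands Lp Lm B D (leaf X) (Node X d (map leaf Cs))"
| below:
    "\<lbrakk>i < length ts; expands Lp Lm (B \<union> items (ts ! i)) (D \<union> set_option d) (ts ! i) t'\<rbrakk>
     \<Longrightarrow> expands Lp Lm B D (Node X d ts) (Node X d (ts[i := t']))"

primrec is_position :: "nat list \<Rightarrow> ('l, 'a) tree \<Rightarrow> bool" where
  "is_position [] t \<longleftrightarrow> True"
| "is_position (i # p) t \<longleftrightarrow> i < length (children t) \<and> is_position p (children t ! i)"

definition finite_tree :: "('l, 'a) tree \<Rightarrow> bool" where
  "finite_tree t \<longleftrightarrow> finite {p. is_position p t}"

end

theory Submission
  imports Defs
begin

text \<open>
  To a branch assign the number \<open>w + (l + 2w)\<^sup>2 - e + b\<close>, where \<open>w\<close> is the total size of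
  the labelled formulas not yet decomposed, \<open>l\<close> the number of labels, \<open>e\<close> the number of
  equality statements, and \<open>b\<close> is 1 on an open branch and 0 on a closed one.
  A decomposition decreases \<open>w\<close> and adds at most two labels, so \<open>l + 2w\<close> does not increase;
  every other rule increases \<open>e\<close>, which is at most \<open>l\<^sup>2\<close>, or closes the branch.
  Every rule application thus decreases this number, and as a rule has at most four
  alternatives, a tableau whose root has measure \<open>m\<close> has at most \<open>5\<^sup>m\<close> nodes.
  Applying a rule adds nodes, so only finitely many rules can be applied in succession.
\<close>

section \<open>Quantities attached to a branch\<close>

definition branch_labels :: "('l, 'a) item set \<Rightarrow> 'l set" where
  "branch_labels B = (\<Union>i\<in>B. labels i)"

definition formulas :: "('l, 'a) item set \<Rightarrow> ('l \<times> 'a fm) set" where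
  "formulas B = {(w, \<phi>). LForm w \<phi> \<in> B}"

definition equations :: "('l, 'a) item set \<Rightarrow> ('l \<times> 'l) set" where
  "equations B = {(w, v). EqL w v \<in> B}"

definition weight :: "('l \<times> 'a fm) set \<Rightarrow> nat" where
  "weight F = (\<Sum>(w, \<phi>)\<in>F. size \<phi>)"

definition label_bound :: "('l, 'a) item set \<Rightarrow> ('l \<times> 'a fm) set \<Rightarrow> nat" where
  "label_bound B D = card (branch_labels B) + 2 * weight (formulas B - D)"

text \<open>The difference is truncated subtraction on naturals; \<open>card_equations_le\<close>
  ensures that nothing is cut off on a finite branch.\<close>

definition branch_measure :: "('l, 'a) item set \<Rightarrow> ('l \<times> 'a fm) set \<Rightarrow> nat" where
  "branch_measure B D = weight (formulas B - D)
     + ((label_bound B D)\<^sup>2 - card (equations B)) + (if Bot \<in> B then 0 else 1)"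

lemma finite_labels: "finite (labels i)"
  by (cases i) auto

lemma finite_branch_labels: "finite B \<Longrightarrow> finite (branch_labels B)"
  by (simp add: branch_labels_def finite_labels)

lemma finite_formulas: "finite B \<Longrightarrow> finite (formulas B)"
proof -
  assume "finite B"
  moreover have "formulas B = (\<lambda>(w, \<phi>). LForm w \<phi>) -` B"
    by (auto simp: formulas_def)
  ultimately show ?thesis by (simp add: finite_vimageI inj_def)
qed

lemma equations_subset: "equations B \<subseteq> branch_labels B \<times> branch_labels B"
  by (force simp: equations_def branch_labels_def)

lemma finite_equations: "finite B \<Longrightarrow> finite (equations B)"
  using equations_subset finite_branch_labels by (metis finite_SigmaI finite_subset)

lemma card_equations_le:
  assumes "finite B"
  shows "card (equations B) \<le> (label_bound B D)\<^sup>2"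
proof -
  have "card (equations B) \<le> card (branch_labels B \<times> branch_labels B)"
    using assms by (intro card_mono equations_subset) (simp add: finite_branch_labels)
  also have "\<dots> = (card (branch_labels B))\<^sup>2"
    by (simp add: card_cartesian_product power2_eq_square)
  also have "\<dots> \<le> (label_bound B D)\<^sup>2"
    by (intro power_mono) (simp_all add: label_bound_def)
  finally show ?thesis .
qed

lemma branch_labels_Un: "branch_labels (B \<union> C) = branch_labels B \<union> branch_labels C"
  by (auto simp: branch_labels_def)

lemma formulas_Un: "formulas (B \<union> C) = formulas B \<union> formulas C"
  by (auto simp: formulas_def)

lemma formulas_simps:
  "formulas {} = {}"
  "formulas (insert (LForm w \<phi>) B) = insert (w, \<phi>) (formulas B)"
  "formulas (insert (EqL w v) B) = formulas B"
  "formulas (insert (NeqL w v) B) = formulas B"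
  "formulas (insert Bot B) = formulas B"
  by (auto simp: formulas_def)

lemma weight_mono: "finite G \<Longrightarrow> F \<subseteq> G \<Longrightarrow> weight F \<le> weight G"
  by (simp add: weight_def sum_mono2)

lemma weight_Un_le: "finite F \<Longrightarrow> finite G \<Longrightarrow> weight (F \<union> G) \<le> weight F + weight G"
  by (simp add: weight_def sum_Un_nat)

lemma weight_singleton: "weight {(w, \<phi>)} = size \<phi>"
  by (simp add: weight_def)

text \<open>Equality can fail: the two labelled formulas may coincide and are then counted
  once.\<close>

lemma weight_pair_le: "weight {(v, \<phi>), (u, \<psi>)} \<le> size \<phi> + size \<psi>"
  using weight_Un_le[of "{(v, \<phi>)}" "{(u, \<psi>)}"]
  by (simp add: weight_singleton insert_commute)

section \<open>Effect of the rules on a branch\<close>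

lemma decomp_rule_formula: "decomp_rule Lp Lm B w \<phi> Cs \<Longrightarrow> LForm w \<phi> \<in> B"
  by (auto elim: decomp_rule.cases)

text \<open>The conclusions label only immediate subformulas, and \<open>size\<close> counts the
  principal connective on top of them. This strict drop pays for the two labels.\<close>

lemma decomp_rule_conclusion:
  assumes "decomp_rule Lp Lm B w \<phi> Cs" "C \<in> set Cs"
  shows "finite C" "card (branch_labels C) \<le> 2" "weight (formulas C) < size \<phi>"
proof -
  have less: "weight {(v, \<chi>), (u, \<psi>)} < Suc (size \<chi> + size \<psi>)"
    for v u :: 'a and \<chi> \<psi> :: "'b fm"
    using weight_pair_le[of v \<chi> u \<psi>] by simp
  have card2: "card {v, u} \<le> 2" for v u :: 'a
    by (simp add: card_insert_if)
  show "finite C"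
    using assms by (auto elim!: decomp_rule.cases)
  show "card (branch_labels C) \<le> 2"
    using assms by (auto elim!: decomp_rule.cases simp: branch_labels_def card2 insert_commute
        card_insert_if)
  show "weight (formulas C) < size \<phi>"
    using assms by (auto elim!: decomp_rule.cases
        simp: formulas_simps weight_singleton less)
qed

lemma decomp_rule_alternatives:
  "decomp_rule Lp Lm B w \<phi> Cs \<Longrightarrow> Cs \<noteq> [] \<and> length Cs \<le> 4"
  by (auto elim: decomp_rule.cases)

lemma applicable_alternatives:
  "applicable Lp Lm B D d Cs \<Longrightarrow> Cs \<noteq> [] \<and> length Cs \<le> 4"
  by (auto elim!: applicable.cases dest: decomp_rule_alternatives)

lemma applicable_finite:
  "applicable Lp Lm B D d Cs \<Longrightarrow> C \<in> set Cs \<Longrightarrow> finite C"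
  by (auto elim!: applicable.cases intro: decomp_rule_conclusion(1))

text \<open>Equality rules relate labels that already occur, so they leave
  \<open>label_bound\<close> unchanged.\<close>

lemma equality_rule_conclusion:
  assumes "equality_rule B c"
  obtains w v where "c = EqL w v" "w \<in> branch_labels B" "v \<in> branch_labels B"
  using assms by cases (force simp: branch_labels_def)+

section \<open>Decrease of the measure\<close>

lemma branch_measure_decomp:
  assumes "finite B" and rule: "decomp_rule Lp Lm B w \<phi> Cs" "C \<in> set Cs"
    and "Bot \<notin> B" "(w, \<phi>) \<notin> D"
  shows "branch_measure (B \<union> C) (insert (w, \<phi>) D) < branch_measure B D"
proof -
  let ?P = "formulas B - D" and ?B = "B \<union> C" and ?D = "insert (w, \<phi>) D"
  note C = decomp_rule_conclusion[OF rule]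
  have fin: "finite ?P" "finite (formulas C)"
    using assms C by (simp_all add: finite_formulas)
  have mem: "(w, \<phi>) \<in> ?P"
    using decomp_rule_formula[OF rule(1)] assms by (simp add: formulas_def)
  \<comment> \<open>All conclusions are counted as pending; some may already be pending or
    decomposed, hence only an upper bound.\<close>
  have "weight (formulas ?B - ?D) \<le> weight ((?P - {(w, \<phi>)}) \<union> formulas C)"
    using fin by (intro weight_mono) (auto simp: formulas_Un)
  also have "\<dots> \<le> weight (?P - {(w, \<phi>)}) + weight (formulas C)"
    using fin by (intro weight_Un_le) auto
  also have "\<dots> < weight (?P - {(w, \<phi>)}) + size \<phi>"
    using C by simp
  also have "\<dots> = weight ?P"
    using sum.remove[OF fin(1) mem, of "\<lambda>(w, \<phi>). size \<phi>"] by (simp add: weight_def)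
  finally have W: "weight (formulas ?B - ?D) < weight ?P" .
  have "card (branch_labels ?B) \<le> card (branch_labels B) + 2"
    using C(2) card_Un_le[of "branch_labels B" "branch_labels C"]
    by (simp add: branch_labels_Un)
  \<comment> \<open>The weight drops by at least 1 and enters with factor 2, which offsets the two
    new labels.\<close>
  then have "label_bound ?B ?D \<le> label_bound B D"
    using W by (simp add: label_bound_def)
  then have "(label_bound ?B ?D)\<^sup>2 \<le> (label_bound B D)\<^sup>2"
    by (simp add: power_mono)
  \<comment> \<open>An alternative may itself add an equation, which can only lower the
    difference.\<close>
  moreover have "card (equations B) \<le> card (equations ?B)"
    using assms C by (intro card_mono finite_equations) (auto simp: equations_def)
  ultimately have "(label_bound ?B ?D)\<^sup>2 - card (equations ?B)
      \<le> (label_bound B D)\<^sup>2 - card (equations B)"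
    by (rule diff_le_mono[THEN order_trans, OF _ diff_le_mono2])
  \<comment> \<open>The last summand is 1 on the open branch \<open>B\<close>, so it cannot
    increase.\<close>
  then show ?thesis
    using W \<open>Bot \<notin> B\<close> by (simp add: branch_measure_def)
qed

lemma branch_measure_equality:
  assumes "finite B" and "equality_rule B c" "c \<notin> B" "Bot \<notin> B"
  shows "branch_measure (B \<union> {c}) D < branch_measure B D"
proof -
  obtain w v where c: "c = EqL w v" "w \<in> branch_labels B" "v \<in> branch_labels B"
    using assms equality_rule_conclusion by metis
  have fm: "formulas (B \<union> {c}) = formulas B"
    by (simp add: c formulas_simps)
  have "branch_labels (B \<union> {c}) = branch_labels B"
    using c by (auto simp: branch_labels_def)
  then have bound: "label_bound (B \<union> {c}) D = label_bound B D"
    by (simp add: label_bound_def fm del: Un_insert_right)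
  have "equations (B \<union> {c}) = insert (w, v) (equations B)" "(w, v) \<notin> equations B"
    using c assms by (auto simp: equations_def)
  then have "card (equations (B \<union> {c})) = Suc (card (equations B))"
    using assms finite_equations by (metis card_insert_disjoint)
  \<comment> \<open>Applied to the extended branch, the bound shows that the old difference was
    positive; otherwise truncated subtraction could stay at 0.\<close>
  moreover have "card (equations (B \<union> {c})) \<le> (label_bound (B \<union> {c}) D)\<^sup>2"
    using assms by (intro card_equations_le) auto
  ultimately show ?thesis
    using c assms bound fm by (simp add: branch_measure_def)
qed

text \<open>\<open>Bot\<close> carries no labels, formulas or equations, so only the last summand
  changes, from 1 to 0.\<close>

lemma branch_measure_closure:
  assumes "Bot \<notin> B"
  shows "branch_measure (B \<union> {Bot}) D < branch_measure B D"
proof -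
  have "formulas (B \<union> {Bot}) = formulas B" "branch_labels (B \<union> {Bot}) = branch_labels B"
    "equations (B \<union> {Bot}) = equations B"
    by (simp add: formulas_simps) (auto simp: branch_labels_def equations_def)
  then show ?thesis
    using assms by (simp add: branch_measure_def label_bound_def)
qed

lemma branch_measure_applicable:
  assumes "applicable Lp Lm B D d Cs" "C \<in> set Cs" "finite B"
  shows "branch_measure (B \<union> C) (D \<union> set_option d) < branch_measure B D"
  using assms
proof cases
  case closure
  then show ?thesis using assms branch_measure_closure by auto
next
  case (equality c)
  then show ?thesis using assms branch_measure_equality[of B c D] by simp
next
  case (decomp w \<phi>)
  then show ?thesis using assms branch_measure_decomp[of B Lp Lm w \<phi> Cs C D] by simp
qed

section \<open>Counting the nodes of a tree\<close>

definition positions :: "('l, 'a) tree \<Rightarrow> nat list set" where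
  "positions t = {p. is_position p t}"

lemma positions_Node:
  "positions (Node X d ts) = insert [] (\<Union>i<length ts. Cons i ` positions (ts ! i))"
proof -
  have "is_position p (Node X d ts) \<longleftrightarrow>
      p \<in> insert [] (\<Union>i<length ts. Cons i ` positions (ts ! i))" for p
    by (cases p) (auto simp: positions_def)
  then show ?thesis by (auto simp: positions_def)
qed

text \<open>Addresses in different subtrees differ in their first index; the extra one is the root
  \<open>[]\<close>.\<close>

lemma card_positions_Node:
  assumes "\<And>i. i < length ts \<Longrightarrow> finite (positions (ts ! i))"
  shows "finite (positions (Node X d ts))"
    and "card (positions (Node X d ts)) = Suc (\<Sum>i<length ts. card (positions (ts ! i)))"
proof -
  have "card (\<Union>i<length ts. Cons i ` positions (ts ! i))
      = (\<Sum>i<length ts. card (Cons i ` positions (ts ! i)))"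
    using assms by (intro card_UN_disjoint) auto
  also have "\<dots> = (\<Sum>i<length ts. card (positions (ts ! i)))"
    by (simp add: card_image)
  moreover have "[] \<notin> (\<Union>i<length ts. Cons i ` positions (ts ! i))"
    by auto
  ultimately show "card (positions (Node X d ts)) = Suc (\<Sum>i<length ts. card (positions (ts ! i)))"
    using assms by (simp add: positions_Node)
  show "finite (positions (Node X d ts))"
    using assms by (simp add: positions_Node)
qed

text \<open>Although \<open>grown\<close> is coinductive, induction on the measure applies, as every
  child has a smaller one. Base 5 leaves room for four subtrees and the root.\<close>

lemma grown_card_positions:
  assumes "grown Lp Lm B D t" "finite B"
  shows "finite (positions t) \<and> card (positions t) \<le> 5 ^ branch_measure B D"
  using assms
proof (induction "branch_measure B D" arbitrary: B D t rule: less_induct)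
  case less
  from less.prems(1) show ?case
  proof cases
    case (stop X)
    then show ?thesis by (simp add: positions_Node)
  next
    case (apply_rule d Cs ts X)
    let ?m = "branch_measure B D"
    \<comment> \<open>\<open>0 < ?m\<close> is carried along because
      \<open>5 * 5 ^ (?m - 1) = 5 ^ ?m\<close> fails for \<open>?m = 0\<close>.\<close>
    have child: "finite (positions (ts ! i)) \<and> card (positions (ts ! i)) \<le> 5 ^ (?m - 1)
        \<and> 0 < ?m" if "i < length ts" for i
    proof -
      let ?B = "B \<union> items (ts ! i)" and ?D = "D \<union> set_option d"
      have mem: "items (ts ! i) \<in> set Cs"
        using that apply_rule by auto
      have lt: "branch_measure ?B ?D < ?m"
        using branch_measure_applicable apply_rule mem less.prems by blast
      have "finite (positions (ts ! i)) \<and> card (positions (ts ! i)) \<le> 5 ^ branch_measure ?B ?D"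
        using less.hyps[OF lt] apply_rule(4) that less.prems(2)
          applicable_finite[OF apply_rule(2) mem] by simp
      moreover have "(5::nat) ^ branch_measure ?B ?D \<le> 5 ^ (?m - 1)"
        using lt by (intro power_increasing) auto
      ultimately show ?thesis using lt by linarith
    qed
    \<comment> \<open>A rule has at least one alternative, so child 0 exists and yields
      \<open>0 < ?m\<close>.\<close>
    have len: "0 < length ts" "length ts \<le> 4"
      using applicable_alternatives apply_rule by fastforce+
    have "(\<Sum>i<length ts. card (positions (ts ! i))) \<le> (\<Sum>i<length ts. 5 ^ (?m - 1))"
      using child by (intro sum_mono) auto
    also have "\<dots> \<le> 4 * 5 ^ (?m - 1)"
      using len by simp
    finally have "Suc (\<Sum>i<length ts. card (positions (ts ! i))) \<le> 1 + 4 * 5 ^ (?m - 1)"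
      by simp
    also have "\<dots> \<le> 5 * 5 ^ (?m - 1)"
      by simp
    also have "\<dots> = 5 ^ ?m"
      using child[OF len(1)] by (simp flip: power_Suc)
    finally show ?thesis
      using card_positions_Node[of ts X d] child apply_rule by simp
  qed
qed

section \<open>Stepwise construction of tableaux\<close>

lemma expands_items: "expands Lp Lm B D t t' \<Longrightarrow> items t' = items t"
  by (induction rule: expands.induct) auto

text \<open>Transfers the size bound to trees built step by step: new leaves are justified by
  \<open>stop\<close>, and applications higher up survive because an expansion keeps the items at
  the root of the subtree.\<close>

lemma grown_expands:
  "expands Lp Lm B D t t' \<Longrightarrow> grown Lp Lm B D t \<Longrightarrow> grown Lp Lm B D t'"
proof (induction rule: expands.induct)
  case (here B D d Cs X)
  then show ?case
    by (auto intro!: grown.apply_rule grown.stop simp: comp_def)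
next
  case (below i ts B D d t' X)
  from below.prems below.hyps(1) obtain Cs where Cs: "applicable Lp Lm B D d Cs"
      "map items ts = Cs"
      "\<forall>t\<in>set ts. grown Lp Lm (B \<union> items t) (D \<union> set_option d) t"
    by (auto elim: grown.cases)
  note it = expands_items[OF below.hyps(2)]
  have "map items (ts[i := t']) = Cs"
    using Cs(2) it below.hyps(1) by (simp add: map_update flip: nth_map)
  moreover have "grown Lp Lm (B \<union> items t') (D \<union> set_option d) t'"
    using below.IH Cs(3) below.hyps(1) it by simp
  then have "\<forall>t\<in>set (ts[i := t']). grown Lp Lm (B \<union> items t) (D \<union> set_option d) t"
    using Cs(3) set_update_subset_insert by fastforce
  ultimately show ?case
    using Cs(1) by (blast intro: grown.apply_rule)
qed

lemma expands_positions: "expands Lp Lm B D t t' \<Longrightarrow> positions t \<subset> positions t'"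
proof (induction rule: expands.induct)
  case (here B D d Cs X)
  \<comment> \<open>\<open>Cs\<close> is nonempty, so the expanded leaf gains a node at
    \<open>[0]\<close>; this gives strictness.\<close>
  then have "[0] \<in> positions (Node X d (map leaf Cs))"
    using applicable_alternatives by (fastforce simp: positions_def)
  then show ?case by (auto simp: positions_Node)
next
  case (below i ts B D d t' X)
  then obtain p where "p \<in> positions t'" "p \<notin> positions (ts ! i)"
    by blast
  with below.hyps have "i # p \<in> positions (Node X d (ts[i := t']))"
      "i # p \<notin> positions (Node X d ts)"
    by (auto simp: positions_def)
  moreover have "positions (ts ! j) \<subseteq> positions (ts[i := t'] ! j)" if "j < length ts" for j
    using that below.IH by (cases "i = j") auto
  then have "positions (Node X d ts) \<subseteq> positions (Node X d (ts[i := t']))"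
    by (fastforce simp: positions_Node)
  ultimately show ?case by blast
qed

text \<open>All trees of the sequence are grown over the same \<open>B\<close> and \<open>D\<close>,
  so one bound serves them all, while each step adds at least one node.\<close>

lemma no_infinite_expansion:
  assumes "finite B" "grown Lp Lm B D (S 0)"
    and step: "\<And>n. expands Lp Lm B D (S n) (S (Suc n))"
  shows False
proof -
  have "grown Lp Lm B D (S n)" for n
    by (induction n) (use assms grown_expands in blast)+
  then have bound: "finite (positions (S n))" "card (positions (S n)) \<le> 5 ^ branch_measure B D"
    for n
    using grown_card_positions assms(1) by blast+
  have "n \<le> card (positions (S n))" for n
  proof (induction n)
    case (Suc n)
    have "card (positions (S n)) < card (positions (S (Suc n)))"
      using expands_positions[OF step] bound(1) by (rule psubset_card_mono[rotated])
    then show ?case using Suc by simp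
  qed simp
  from this[of "Suc (5 ^ branch_measure B D)"] bound(2)[of "Suc (5 ^ branch_measure B D)"]
  show False by simp
qed

theorem theorem3:
  fixes AF :: "'a set" and Lp Lm :: "'l set" and \<phi> :: "'a fm" and w :: 'l
  assumes "countable AF" and "infinite AF"
    and "countable Lp" and "infinite Lp"
    and "countable Lm" and "infinite Lm"
    and "Lp \<inter> Lm = {}"
    and "\<phi> \<in> FOR AF" and "w \<in> Lp \<union> Lm"
  shows "(\<forall>T. tableau Lp Lm w \<phi> T \<longrightarrow> finite_tree T) \<and>
         \<not> (\<exists>S :: nat \<Rightarrow> ('l, 'a) tree.
               S 0 = leaf {LForm w \<phi>} \<and>
               (\<forall>n. expands Lp Lm {LForm w \<phi>} {} (S n) (S (Suc n))))"
proof (intro conjI allI impI notI)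
  fix T :: "('l, 'a) tree"
  assume "tableau Lp Lm w \<phi> T"
  then show "finite_tree T"
    using grown_card_positions[of Lp Lm "{LForm w \<phi>}" "{}" T]
    by (simp add: tableau_def finite_tree_def positions_def)
next
  assume "\<exists>S :: nat \<Rightarrow> ('l, 'a) tree. S 0 = leaf {LForm w \<phi>} \<and>
      (\<forall>n. expands Lp Lm {LForm w \<phi>} {} (S n) (S (Suc n)))"
  then show False
    \<comment> \<open>The one-node tree is grown by \<open>stop\<close>, which supplies the start of
      the sequence.\<close>
    using no_infinite_expansion[of "{LForm w \<phi>}"] grown.stop
    by (metis finite.emptyI finite.insertI)
qed

end
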